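(* Let $\Gamma$ be a finite simplicial graph and let $H_\Phi$ be a generalized Bestvina-Brady subgroup of the right-angled Artin group $A_\Gamma$. Then $H_\Phi$ is finitely generated if and only if each basis subgraph of $\Gamma$ with respect to $\Phi$ is connected and dominating.
   Context: For a finite simplicial graph $\Gamma$, the right-angled Artin group $A_\Gamma$ has generating set the vertices of $\Gamma$ and relations $st=ts$ whenever $s,t$ are adjacent vertices. Generalized Bestvina-Brady subgroups: let $S$ be the vertex set of $\Gamma$ and let $d$ be a positive integer with $d\le |S|$. Label each vertex of $\Gamma$ with an integer in $\{1,\dots,d\}$ so that the homomorphism $\Phi:A_\Gamma\to\mathbb{Z}^d$ sending each vertex with label $i$ to the $i$-th standard basis vector $e_i$ is an epimorphism (i.e. every label is used). The subgroup $H_\Phi=\ker\Phi$ is the generalized Bestvina-Brady subgroup of $A_\Gamma$ with respect to $\Phi$. For $1\le i\le d$ let $S_i$ be the set of vertices mapped to $e_i$ by $\Phi$; the basis subgraph $\Gamma_i$ is the induced subgraph of $\Gamma$ with vertex set $S_i$. A subgraph $\Gamma_1$ of $\Gamma$ is dominating if $d(v,\Gamma_1)=1$ for every vertex $v$ of $\Gamma$ not in $\Gamma_1$, i.e. every such $v$ is adjacent to some vertex of $\Gamma_1$. *)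

theory Defs
  imports
    "HOL-Algebra.Product_Groups"
    "Graph_Theory.Digraph_Component"
begin

section \<open>Groups given by generators and relations\<close>

text \<open>The letter \<open>(x, True)\<close> stands for the generator \<open>x\<close> and \<open>(x, False)\<close> for its formal inverse.\<close>

type_synonym 'a gword = "('a \<times> bool) list"

definition gwords :: "'a set \<Rightarrow> 'a gword set" where
  "gwords X = lists (X \<times> UNIV)"

text \<open>A pair \<open>(l, r) \<in> R\<close> is the relation \<open>l = r\<close>.\<close>

inductive pres_step :: "'a set \<Rightarrow> ('a gword \<times> 'a gword) set \<Rightarrow> 'a gword \<Rightarrow> 'a gword \<Rightarrow> bool"
  for X R where
  cancel: "\<lbrakk>u \<in> gwords X; v \<in> gwords X; x \<in> X\<rbrakk>
    \<Longrightarrow> pres_step X R (u @ [(x, b), (x, \<not> b)] @ v) (u @ v)"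
| relation: "\<lbrakk>u \<in> gwords X; v \<in> gwords X; l \<in> gwords X; r \<in> gwords X; (l, r) \<in> R\<rbrakk>
    \<Longrightarrow> pres_step X R (u @ l @ v) (u @ r @ v)"

definition pres_rel :: "'a set \<Rightarrow> ('a gword \<times> 'a gword) set \<Rightarrow> 'a gword rel" where
  "pres_rel X R = {(u, v). u \<in> gwords X \<and> v \<in> gwords X \<and> equivclp (pres_step X R) u v}"

definition presented_group :: "'a set \<Rightarrow> ('a gword \<times> 'a gword) set \<Rightarrow> 'a gword set monoid" where
  "presented_group X R =
    \<lparr>carrier = gwords X // pres_rel X R,
     monoid.mult = (\<lambda>A B. \<Union>u\<in>A. \<Union>v\<in>B. pres_rel X R `` {u @ v}),
     one = pres_rel X R `` {[]}\<rparr>"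

definition pres_gen :: "'a set \<Rightarrow> ('a gword \<times> 'a gword) set \<Rightarrow> 'a \<Rightarrow> 'a gword set" where
  "pres_gen X R x = pres_rel X R `` {[(x, True)]}"

lemma gwords_simps [simp]:
  "[] \<in> gwords X"
  "p # w \<in> gwords X \<longleftrightarrow> fst p \<in> X \<and> w \<in> gwords X"
  "u @ v \<in> gwords X \<longleftrightarrow> u \<in> gwords X \<and> v \<in> gwords X"
  by (auto simp: gwords_def mem_Times_iff)

lemma equiv_pres_rel: "equiv (gwords X) (pres_rel X R)"
proof (rule equivI)
  show "refl_on (gwords X) (pres_rel X R)"
    by (auto simp: refl_on_def pres_rel_def)
  show "sym (pres_rel X R)"
    by (auto simp: sym_def pres_rel_def dest: equivclp_sym)
  show "trans (pres_rel X R)"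
    by (auto simp: trans_def pres_rel_def dest: equivclp_trans)
qed (auto simp: pres_rel_def)

lemma pres_step_append:
  assumes "pres_step X R u v" "a \<in> gwords X" "b \<in> gwords X"
  shows "pres_step X R (a @ u @ b) (a @ v @ b)"
  using assms(1)
proof cases
  case (cancel p q x c)
  then show ?thesis
    using pres_step.cancel[of "a @ p" X "q @ b" x R c] assms(2,3) by simp
next
  case (relation p q l r)
  then show ?thesis
    using pres_step.relation[of "a @ p" X "q @ b" l r R] assms(2,3) by simp
qed

lemma equivclp_pres_step_append:
  assumes "equivclp (pres_step X R) u v" "a \<in> gwords X" "b \<in> gwords X"
  shows "equivclp (pres_step X R) (a @ u @ b) (a @ v @ b)"
  using assms(1)
proof (induction rule: equivclp_induct)
  case (step y z)
  have "equivclp (pres_step X R) (a @ y @ b) (a @ z @ b)"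
    using step.hyps(2) pres_step_append[OF _ assms(2,3)] by blast
  then show ?case
    using step.IH equivclp_trans by metis
qed simp

lemma pres_rel_append:
  assumes "(u, u') \<in> pres_rel X R" "(v, v') \<in> pres_rel X R"
  shows "(u @ v, u' @ v') \<in> pres_rel X R"
proof -
  have w: "u \<in> gwords X" "u' \<in> gwords X" "v \<in> gwords X" "v' \<in> gwords X"
    and e: "equivclp (pres_step X R) u u'" "equivclp (pres_step X R) v v'"
    using assms by (auto simp: pres_rel_def)
  have "equivclp (pres_step X R) (u @ v) (u' @ v)"
    using equivclp_pres_step_append[OF e(1), of "[]" v] w by simp
  moreover have "equivclp (pres_step X R) (u' @ v) (u' @ v')"
    using equivclp_pres_step_append[OF e(2), of u' "[]"] w by simp
  ultimately show ?thesis
    using w equivclp_trans by (fastforce simp: pres_rel_def)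
qed

lemma presented_group_mult:
  assumes "u \<in> gwords X" "v \<in> gwords X"
  shows "pres_rel X R `` {u} \<otimes>\<^bsub>presented_group X R\<^esub> pres_rel X R `` {v} = pres_rel X R `` {u @ v}"
proof -
  have "(\<lambda>u v. pres_rel X R `` {u @ v}) respects2 pres_rel X R"
    by (rule congruent2I', rule equiv_class_eq[OF equiv_pres_rel], rule pres_rel_append)
  from UN_equiv_class2[OF equiv_pres_rel equiv_pres_rel this assms]
  show ?thesis by (simp add: presented_group_def)
qed

lemma presented_group_carrierE:
  assumes "A \<in> carrier (presented_group X R)"
  obtains u where "u \<in> gwords X" "A = pres_rel X R `` {u}"
  using assms by (auto simp: presented_group_def elim: quotientE)

lemma presented_group_carrierI:
  "u \<in> gwords X \<Longrightarrow> pres_rel X R `` {u} \<in> carrier (presented_group X R)"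
  by (simp add: presented_group_def quotientI)

lemma pres_rel_inverse:
  assumes "u \<in> gwords X"
  shows "\<exists>v \<in> gwords X. (v @ u, []) \<in> pres_rel X R"
  using assms
proof (induction u)
  case Nil
  then show ?case
    by (intro bexI[of _ "[]"]) (auto simp: pres_rel_def)
next
  case (Cons p u)
  obtain x b where p: "p = (x, b)" by fastforce
  with Cons obtain v where v: "v \<in> gwords X" "(v @ u, []) \<in> pres_rel X R" and x: "x \<in> X"
    and u: "u \<in> gwords X" by auto
  have "pres_step X R (v @ [(x, \<not> b), (x, \<not> \<not> b)] @ u) (v @ u)"
    by (rule pres_step.cancel) (use v x u in auto)
  then have "((v @ [(x, \<not> b)]) @ p # u, v @ u) \<in> pres_rel X R"
    using v x u p by (auto simp: pres_rel_def)
  then have "((v @ [(x, \<not> b)]) @ p # u, []) \<in> pres_rel X R"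
    using v(2) equiv_pres_rel[of X R] by (meson equivE transE)
  then show ?case
    using v x by (intro bexI[of _ "v @ [(x, \<not> b)]"]) auto
qed

lemma group_presented_group: "group (presented_group X R)"
proof (rule groupI)
  let ?P = "presented_group X R"
  have one: "\<one>\<^bsub>?P\<^esub> = pres_rel X R `` {[]}"
    by (simp add: presented_group_def)
  show "\<one>\<^bsub>?P\<^esub> \<in> carrier ?P"
    unfolding one by (rule presented_group_carrierI) simp
  fix A assume "A \<in> carrier ?P"
  then obtain a where a: "a \<in> gwords X" "A = pres_rel X R `` {a}"
    by (rule presented_group_carrierE)
  show "\<one>\<^bsub>?P\<^esub> \<otimes>\<^bsub>?P\<^esub> A = A"
    using a by (simp add: one presented_group_mult)
  obtain v where v: "v \<in> gwords X" "(v @ a, []) \<in> pres_rel X R"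
    using pres_rel_inverse[OF a(1)] by blast
  then show "\<exists>B\<in>carrier ?P. B \<otimes>\<^bsub>?P\<^esub> A = \<one>\<^bsub>?P\<^esub>"
    using a equiv_class_eq[OF equiv_pres_rel v(2)]
    by (intro bexI[of _ "pres_rel X R `` {v}"])
       (auto simp: one presented_group_mult intro: presented_group_carrierI)
  fix B assume "B \<in> carrier ?P"
  then obtain b where b: "b \<in> gwords X" "B = pres_rel X R `` {b}"
    by (rule presented_group_carrierE)
  show "A \<otimes>\<^bsub>?P\<^esub> B \<in> carrier ?P"
    using a b by (auto simp: presented_group_mult intro: presented_group_carrierI)
  fix C assume "C \<in> carrier ?P"
  then obtain c where "c \<in> gwords X" "C = pres_rel X R `` {c}"
    by (rule presented_group_carrierE)
  then show "A \<otimes>\<^bsub>?P\<^esub> B \<otimes>\<^bsub>?P\<^esub> C = A \<otimes>\<^bsub>?P\<^esub> (B \<otimes>\<^bsub>?P\<^esub> C)"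
    using a b by (simp add: presented_group_mult)
qed


section \<open>Right-angled Artin groups\<close>

text \<open>
  A finite simplicial graph is a \<open>pair_graph\<close>: a finite, symmetric, loop-free set of ordered pairs.
\<close>

definition raag_relations :: "'v pair_pre_digraph \<Rightarrow> ('v gword \<times> 'v gword) set" where
  "raag_relations G = {([(s, True), (t, True)], [(t, True), (s, True)]) | s t. s \<rightarrow>\<^bsub>G\<^esub> t}"

definition raag :: "'v pair_pre_digraph \<Rightarrow> 'v gword set monoid" where
  "raag G = presented_group (pverts G) (raag_relations G)"

definition raag_gen :: "'v pair_pre_digraph \<Rightarrow> 'v \<Rightarrow> 'v gword set" where
  "raag_gen G = pres_gen (pverts G) (raag_relations G)"


section \<open>Generalized Bestvina-Brady subgroups\<close>

text \<open>
  Elements of \<open>Zpow d\<close> and the vectors \<open>std_basis d i\<close> are extensional functions on \<open>{1..d}\<close>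
  (value \<open>undefined\<close> elsewhere).
\<close>

definition Zpow :: "nat \<Rightarrow> (nat \<Rightarrow> int) monoid" where
  "Zpow d = product_group {1..d} (\<lambda>_. integer_group)"

definition std_basis :: "nat \<Rightarrow> nat \<Rightarrow> (nat \<Rightarrow> int)" where
  "std_basis d i = (\<lambda>j\<in>{1..d}. if j = i then 1 else 0)"

definition labelling_epi ::
  "'v pair_pre_digraph \<Rightarrow> nat \<Rightarrow> ('v \<Rightarrow> nat) \<Rightarrow> ('v gword set \<Rightarrow> (nat \<Rightarrow> int)) \<Rightarrow> bool" where
  "labelling_epi G d lab \<Phi> \<longleftrightarrow>
     lab \<in> pverts G \<rightarrow> {1..d} \<and>
     \<Phi> \<in> epi (raag G) (Zpow d) \<and>
     (\<forall>v\<in>pverts G. \<Phi> (raag_gen G v) = std_basis d (lab v))"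

definition gen_bestvina_brady ::
  "'v pair_pre_digraph \<Rightarrow> nat \<Rightarrow> ('v gword set \<Rightarrow> (nat \<Rightarrow> int)) \<Rightarrow> 'v gword set set" where
  "gen_bestvina_brady G d \<Phi> = kernel (raag G) (Zpow d) \<Phi>"

definition basis_verts ::
  "'v pair_pre_digraph \<Rightarrow> nat \<Rightarrow> ('v gword set \<Rightarrow> (nat \<Rightarrow> int)) \<Rightarrow> nat \<Rightarrow> 'v set" where
  "basis_verts G d \<Phi> i = {v \<in> pverts G. \<Phi> (raag_gen G v) = std_basis d i}"

definition basis_subgraph ::
  "'v pair_pre_digraph \<Rightarrow> nat \<Rightarrow> ('v gword set \<Rightarrow> (nat \<Rightarrow> int)) \<Rightarrow> nat \<Rightarrow> ('v, 'v \<times> 'v) pre_digraph" where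
  "basis_subgraph G d \<Phi> i = with_proj G \<restriction> basis_verts G d \<Phi> i"

definition dominating :: "('v, 'e) pre_digraph \<Rightarrow> ('v, 'e) pre_digraph \<Rightarrow> bool" where
  "dominating H G \<longleftrightarrow> (\<forall>v \<in> verts G - verts H. \<exists>w \<in> verts H. v \<rightarrow>\<^bsub>G\<^esub> w)"

definition finitely_generated :: "('a, 'b) monoid_scheme \<Rightarrow> bool" where
  "finitely_generated K \<longleftrightarrow> (\<exists>A. finite A \<and> A \<subseteq> carrier K \<and> generate K A = carrier K)"


section \<open>Every surjective labelling defines an epimorphism\<close>

definition label_weight :: "('v \<Rightarrow> nat) \<Rightarrow> nat \<Rightarrow> 'v gword \<Rightarrow> int" where
  "label_weight lab i w = (\<Sum>(x, b)\<leftarrow>w. if lab x = i then (if b then 1 else - 1) else 0)"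

lemma label_weight_simps [simp]:
  "label_weight lab i [] = 0"
  "label_weight lab i ((x, b) # w) =
     (if lab x = i then (if b then 1 else - 1) else 0) + label_weight lab i w"
  "label_weight lab i (u @ v) = label_weight lab i u + label_weight lab i v"
  by (simp_all add: label_weight_def)

lemma label_weight_replicate:
  "label_weight lab i (replicate n (x, b)) =
     (if lab x = i then (if b then int n else - int n) else 0)"
  by (induction n) auto

lemma label_weight_concat:
  "label_weight lab i (concat ws) = (\<Sum>w\<leftarrow>ws. label_weight lab i w)"
  by (induction ws) auto

lemma label_weight_pres_rel:
  assumes "(u, v) \<in> pres_rel (pverts G) (raag_relations G)"
  shows "label_weight lab i u = label_weight lab i v"
proof -
  have single: "label_weight lab i u = label_weight lab i v"
    if "pres_step (pverts G) (raag_relations G) u v" for u v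
    using that by cases (auto simp: raag_relations_def)
  have "equivclp (pres_step (pverts G) (raag_relations G)) u v"
    using assms by (simp add: pres_rel_def)
  then show ?thesis
  proof (induction rule: equivclp_induct)
    case (step y z)
    then show ?case
      using single by metis
  qed simp
qed

lemma labelling_epi_exists:
  assumes lab: "lab ` pverts G = {1..d}"
  shows "\<exists>\<Phi>. labelling_epi G d lab \<Phi>"
proof -
  let ?r = "pres_rel (pverts G) (raag_relations G)"
  define wt where "wt u = (\<lambda>i\<in>{1..d}. label_weight lab i u)" for u
  define \<Phi> where "\<Phi> A = the_elem (wt ` A)" for A
  have \<Phi>: "\<Phi> (?r `` {u}) = wt u" if "u \<in> gwords (pverts G)" for u
  proof -
    have "wt v = wt u" if "(u, v) \<in> ?r" for v
      using label_weight_pres_rel[OF that, of lab] by (simp add: wt_def)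
    moreover have "(u, u) \<in> ?r"
      using that by (simp add: pres_rel_def)
    ultimately have "wt ` (?r `` {u}) = {wt u}"
      by blast
    then show ?thesis
      by (simp add: \<Phi>_def)
  qed
  have "\<Phi> \<in> hom (raag G) (Zpow d)"
  proof (rule homI)
    fix A assume "A \<in> carrier (raag G)"
    then obtain a where a: "a \<in> gwords (pverts G)" "A = ?r `` {a}"
      unfolding raag_def by (rule presented_group_carrierE)
    then show "\<Phi> A \<in> carrier (Zpow d)"
      by (auto simp: \<Phi> Zpow_def wt_def)
    fix B assume "B \<in> carrier (raag G)"
    then obtain b where b: "b \<in> gwords (pverts G)" "B = ?r `` {b}"
      unfolding raag_def by (rule presented_group_carrierE)
    show "\<Phi> (A \<otimes>\<^bsub>raag G\<^esub> B) = \<Phi> A \<otimes>\<^bsub>Zpow d\<^esub> \<Phi> B"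
      using a b by (auto simp: raag_def presented_group_mult \<Phi> Zpow_def wt_def)
  qed
  moreover have "z \<in> \<Phi> ` carrier (raag G)" if "z \<in> carrier (Zpow d)" for z
  proof -
    define x where "x = inv_into (pverts G) lab"
    have x: "x i \<in> pverts G \<and> lab (x i) = i" if "i \<in> {1..d}" for i
      using that unfolding x_def lab[symmetric] by (simp add: inv_into_into f_inv_into_f)
    define u where "u = concat (map (\<lambda>i. replicate (nat \<bar>z i\<bar>) (x i, z i \<ge> 0)) [1..<Suc d])"
    have u: "u \<in> gwords (pverts G)"
      using x by (auto simp: u_def gwords_def)
    have "label_weight lab j u = z j" if j: "j \<in> {1..d}" for j
    proof -
      have "label_weight lab j u = (\<Sum>i\<leftarrow>[1..<Suc d]. if lab (x i) = j then z i else 0)"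
        unfolding u_def label_weight_concat map_map
        by (intro arg_cong[of _ _ sum_list] map_cong) (auto simp: label_weight_replicate)
      also have "\<dots> = (\<Sum>i\<in>{1..d}. if lab (x i) = j then z i else 0)"
        unfolding interv_sum_list_conv_sum_set_nat set_upt atLeastLessThanSuc_atLeastAtMost ..
      also have "\<dots> = (\<Sum>i\<in>{1..d}. if i = j then z i else 0)"
        by (rule sum.cong) (use x in auto)
      finally show ?thesis
        using j by simp
    qed
    moreover have "z \<in> extensional {1..d}"
      using that by (simp add: Zpow_def PiE_def)
    ultimately have "wt u = z"
      by (auto simp: wt_def extensional_def)
    then have "z = \<Phi> (?r `` {u})"
      using \<Phi>[OF u] by simp
    then show ?thesis
      unfolding raag_def by (rule image_eqI) (rule presented_group_carrierI[OF u])
  qed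
  moreover have "\<Phi> (raag_gen G v) = std_basis d (lab v)" if "v \<in> pverts G" for v
    using that \<Phi>[of "[(v, True)]"]
    by (auto simp: raag_gen_def pres_gen_def wt_def std_basis_def)
  moreover have "lab \<in> pverts G \<rightarrow> {1..d}"
    unfolding lab[symmetric] by simp
  ultimately have "labelling_epi G d lab \<Phi>"
    unfolding labelling_epi_def epi_iff_subset by blast
  then show ?thesis by blast
qed

end

theory Submission
  imports Defs
begin

text \<open>
  Write \<open>S\<^sub>i\<close> for the set of vertices with label \<open>i\<close>.

  If all \<open>S\<^sub>i\<close> are connected and dominating, take an element \<open>h\<close> of the kernel and a path from \<open>1\<close> to
  \<open>h\<close> in the Cayley graph. Where the \<open>i\<close>-th coordinate of \<open>\<Phi>\<close> is maximal along the path, replace each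
  vertex \<open>g\<close> by \<open>g s\<inverse>\<close> with \<open>s \<in> S\<^sub>i\<close>. An edge with label different from \<open>i\<close> can be pushed down because
  some \<open>s \<in> S\<^sub>i\<close> commutes with it, and different choices of \<open>s\<close> can be joined because \<open>S\<^sub>i\<close> is connected.
  No other coordinate changes, so repeating this for maxima and minima confines the path to
  \<open>\<Phi>\<^sup>-\<^sup>1({0,1}\<^sup>d)\<close>, which is finite modulo the kernel.

  Conversely, let the vertices of \<open>S\<^sub>i\<close> act on the rationals by \<open>y \<mapsto> 2 y + \<tau>\<close> and the other vertices by
  translations. The kernel acts by translations, and if it is finitely generated then these have
  bounded denominators. A vertex not dominated by \<open>S\<^sub>i\<close>, or two points in different components of
  \<open>S\<^sub>i\<close>, allow a choice of \<open>\<tau>\<close> for which arbitrarily large powers of 2 occur as denominators.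
\<close>

section \<open>Pushing paths in the Cayley graph\<close>

text \<open>All that pushing asks of a right-angled Artin group: generators, an additive level map
  and enough commuting pairs, recorded in \<open>label_connected\<close> and
  \<open>label_dominating\<close>. Levels vanish outside \<open>I\<close>, so level vectors can be
  compared as plain functions.\<close>

locale levelled_group = group G for G (structure) +
  fixes V :: "'v set" and \<gamma> :: "'v \<Rightarrow> 'a" and I :: "'i set" and lab :: "'v \<Rightarrow> 'i"
    and lev :: "'a \<Rightarrow> 'i \<Rightarrow> int"
  assumes finite_V: "finite V" and finite_I: "finite I"
    and gen_closed [simp]: "v \<in> V \<Longrightarrow> \<gamma> v \<in> carrier G"
    and generates: "carrier G \<subseteq> generate G (\<gamma> ` V)"
    and lev_mult: "\<lbrakk>g \<in> carrier G; h \<in> carrier G\<rbrakk> \<Longrightarrow> lev (g \<otimes> h) j = lev g j + lev h j"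
    and lev_gen: "v \<in> V \<Longrightarrow> lev (\<gamma> v) j = of_bool (lab v = j)"
    and lev_outside: "\<lbrakk>g \<in> carrier G; j \<notin> I\<rbrakk> \<Longrightarrow> lev g j = 0"
    and label_nonempty: "i \<in> I \<Longrightarrow> \<exists>s\<in>V. lab s = i"
    and label_connected: "\<lbrakk>s \<in> V; t \<in> V; lab s = lab t\<rbrakk> \<Longrightarrow>
      (s, t) \<in> {(x, y). x \<in> V \<and> y \<in> V \<and> lab x = lab s \<and> lab y = lab s \<and> \<gamma> x \<otimes> \<gamma> y = \<gamma> y \<otimes> \<gamma> x}\<^sup>*"
    and label_dominating: "\<lbrakk>v \<in> V; i \<in> I; lab v \<noteq> i\<rbrakk> \<Longrightarrow>
      \<exists>s\<in>V. lab s = i \<and> \<gamma> s \<otimes> \<gamma> v = \<gamma> v \<otimes> \<gamma> s"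
begin

section \<open>Signed generators and their levels\<close>

definition sgen :: "bool \<Rightarrow> 'v \<Rightarrow> 'a" where
  "sgen b v = (if b then \<gamma> v else inv \<gamma> v)"

lemma sgen_closed [simp]: "v \<in> V \<Longrightarrow> sgen b v \<in> carrier G"
  by (simp add: sgen_def)

lemma lev_one: "lev \<one> j = 0"
  using lev_mult[of \<one> \<one> j] by simp

lemma lev_inv: "g \<in> carrier G \<Longrightarrow> lev (inv g) j = - lev g j"
  using lev_mult[of g "inv g" j] by (simp add: lev_one)

lemma lev_sgen:
  "v \<in> V \<Longrightarrow> lev (sgen b v) j = (if lab v = j then if b then 1 else - 1 else 0)"
  by (simp add: sgen_def lev_gen lev_inv)

lemma sgen_commute:
  assumes "u \<in> V" "v \<in> V" "\<gamma> u \<otimes> \<gamma> v = \<gamma> v \<otimes> \<gamma> u"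
  shows "sgen b u \<otimes> sgen c v = sgen c v \<otimes> sgen b u"
proof -
  have *: "inv x \<otimes> y = y \<otimes> inv x"
    if "x \<in> carrier G" "y \<in> carrier G" "x \<otimes> y = y \<otimes> x" for x y
    using that by (metis inv_closed inv_solve_left inv_solve_right m_assoc m_closed)
  have "inv \<gamma> u \<otimes> \<gamma> v = \<gamma> v \<otimes> inv \<gamma> u" and v: "inv \<gamma> v \<otimes> \<gamma> u = \<gamma> u \<otimes> inv \<gamma> v"
    using *[of "\<gamma> u" "\<gamma> v"] *[of "\<gamma> v" "\<gamma> u"] assms by simp_all
  moreover have "inv \<gamma> u \<otimes> inv \<gamma> v = inv \<gamma> v \<otimes> inv \<gamma> u"
    using *[of "\<gamma> u" "inv \<gamma> v"] assms v by simp
  ultimately show ?thesis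
    using assms(3) by (simp add: sgen_def)
qed

section \<open>Pushing a path off an extreme level of one coordinate\<close>

definition edges :: "('i \<Rightarrow> int) set \<Rightarrow> 'a rel" where
  "edges C = {(g, g \<otimes> sgen b v) | g b v.
     g \<in> carrier G \<and> v \<in> V \<and> lev g \<in> C \<and> lev (g \<otimes> sgen b v) \<in> C}"

lemma edgesI:
  "\<lbrakk>g \<in> carrier G; v \<in> V; lev g \<in> C; lev (g \<otimes> sgen b v) \<in> C; h = g \<otimes> sgen b v\<rbrakk>
    \<Longrightarrow> (g, h) \<in> edges C"
  by (auto simp: edges_def)

lemma sym_edges: "sym (edges C)"
proof (rule symI)
  fix g h assume "(g, h) \<in> edges C"
  then obtain b v where v: "h = g \<otimes> sgen b v" "g \<in> carrier G" "v \<in> V" "lev g \<in> C" "lev h \<in> C"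
    by (auto simp: edges_def)
  then have "g = h \<otimes> sgen (\<not> b) v"
    by (simp add: sgen_def m_assoc)
  moreover have "h \<in> carrier G"
    using v by simp
  ultimately show "(h, g) \<in> edges C"
    using v by (intro edgesI[of h v C "\<not> b"]) auto
qed

lemma edges_mono: "C \<subseteq> D \<Longrightarrow> edges C \<subseteq> edges D"
  by (fastforce simp: edges_def)

text \<open>All possible pushes of a vertex are kept instead of one chosen push.
  \<open>b = False\<close> lowers a maximum and \<open>b = True\<close> raises a minimum, so one
  argument serves both.\<close>

definition pushes :: "bool \<Rightarrow> 'i \<Rightarrow> int \<Rightarrow> 'a \<Rightarrow> 'a set" where
  "pushes b i n g = (if lev g i = n then {g \<otimes> sgen b s | s. s \<in> V \<and> lab s = i} else {g})"

text \<open>Inside \<open>C\<close> coordinate \<open>i\<close> cannot pass from \<open>n\<close> to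
  \<open>n - \<delta>\<close>, so \<open>n\<close> acts as a maximum or minimum, and
  \<open>C'\<close> is \<open>C\<close> without that layer. Room for two steps is required because
  two pushes of one vertex are joined through level \<open>n + 2 * \<delta>\<close>.\<close>

context
  fixes i n b and C C' :: "('i \<Rightarrow> int) set" and \<delta> :: int
  assumes i: "i \<in> I"
  defines "\<delta> \<equiv> if b then 1 else - 1"
  defines "C' \<equiv> {z \<in> C. z i \<noteq> n}"
  assumes inside: "\<And>z. \<lbrakk>z \<in> C; z i = n\<rbrakk> \<Longrightarrow> z(i := n + \<delta>) \<in> C \<and> z(i := n + 2 * \<delta>) \<in> C"
    and extreme: "\<And>z. z \<in> C \<Longrightarrow> z i \<noteq> n - \<delta>"
begin

lemma lev_push:
  assumes "g \<in> carrier G" "s \<in> V" "lab s = i"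
  shows "lev (g \<otimes> sgen b s) = (lev g)(i := lev g i + \<delta>)"
  using assms by (auto simp: fun_eq_iff lev_mult lev_sgen \<delta>_def)

lemma delta_nonzero: "\<delta> \<noteq> 0"
  by (simp add: \<delta>_def)

text \<open>For commuting \<open>x\<close> and \<open>y\<close> the pushes of \<open>g\<close> along
  \<open>x\<close> and along \<open>y\<close> are both adjacent to the push along both. Chains of
  such pairs come from \<open>label_connected\<close>.\<close>

lemma pushes_connected:
  assumes g: "g \<in> carrier G" "lev g \<in> C" and "a \<in> pushes b i n g" "a' \<in> pushes b i n g"
  shows "(a, a') \<in> (edges C')\<^sup>*"
proof (cases "lev g i = n")
  case True
  then obtain s t where s: "s \<in> V" "lab s = i" "a = g \<otimes> sgen b s"
    and t: "t \<in> V" "lab t = i" "a' = g \<otimes> sgen b t"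
    using assms by (auto simp: pushes_def)
  have "(s, t) \<in> {(x, y). x \<in> V \<and> y \<in> V \<and> lab x = i \<and> lab y = i \<and> \<gamma> x \<otimes> \<gamma> y = \<gamma> y \<otimes> \<gamma> x}\<^sup>*"
    using label_connected[of s t] s t by simp
  then have "(g \<otimes> sgen b s, g \<otimes> sgen b t) \<in> (edges C')\<^sup>*"
  proof (induction rule: rtrancl_induct)
    case (step x y)
    then have xy: "x \<in> V" "y \<in> V" "lab x = i" "lab y = i" "\<gamma> x \<otimes> \<gamma> y = \<gamma> y \<otimes> \<gamma> x"
      by auto
    have C': "(lev g)(i := n + \<delta>) \<in> C'" "(lev g)(i := n + 2 * \<delta>) \<in> C'"
      using inside[OF g(2) True] delta_nonzero by (auto simp: C'_def)
    have *: "(g \<otimes> sgen b u, g \<otimes> sgen b u \<otimes> sgen b w) \<in> edges C'"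
      if "u \<in> V" "w \<in> V" "lab u = i" "lab w = i" for u w
      using that g C' True by (intro edgesI[of _ w C' b]) (auto simp: lev_push add.assoc simp flip: mult_2)
    have "g \<otimes> sgen b x \<otimes> sgen b y = g \<otimes> sgen b y \<otimes> sgen b x"
      using xy g sgen_commute[of x y b b] by (simp add: m_assoc)
    then have "(g \<otimes> sgen b x \<otimes> sgen b y, g \<otimes> sgen b y) \<in> edges C'"
      using *[of y x] xy sym_edges[of C'] by (metis symD)
    with *[of x y] xy have "(g \<otimes> sgen b x, g \<otimes> sgen b y) \<in> (edges C')\<^sup>*"
      by (meson rtrancl.simps)
    with step.IH show ?case by simp
  qed simp
  with s t show ?thesis by simp
qed (use assms in \<open>simp add: pushes_def\<close>)

lemma pushes_edge_extreme:
  assumes e: "(g, h) \<in> edges C" and n: "lev g i = n"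
    and a: "a \<in> pushes b i n g" and c: "c \<in> pushes b i n h"
  shows "(a, c) \<in> (edges C')\<^sup>*"
proof -
  obtain b' v where v: "h = g \<otimes> sgen b' v" "g \<in> carrier G" "v \<in> V" "lev g \<in> C" "lev h \<in> C"
    using e by (auto simp: edges_def)
  have h: "lev h j = lev g j + (if lab v = j then if b' then 1 else - 1 else 0)" for j
    using v by (simp add: lev_mult lev_sgen)
  show ?thesis
  proof (cases "lab v = i")
    case True
    \<comment> \<open>The opposite sign would put \<open>h\<close> at level
      \<open>n - \<delta>\<close>. Hence \<open>h\<close> is itself one of the pushes of
      \<open>g\<close>.\<close>
    have "b' = b"
      using h[of i] extreme[OF v(5)] True n by (auto simp: \<delta>_def split: if_splits)
    then have "h \<in> pushes b i n g" and "c = h"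
      using v True n c h[of i] by (auto simp: pushes_def split: if_splits)
    then show ?thesis
      using pushes_connected[OF v(2,4) a] by simp
  next
    case False
    \<comment> \<open>Both ends lie at level \<open>n\<close>. A vertex \<open>s\<close> of label
      \<open>i\<close> commuting with \<open>v\<close> carries the whole edge to a parallel edge one
      level further in.\<close>
    then obtain s where s: "s \<in> V" "lab s = i" "\<gamma> s \<otimes> \<gamma> v = \<gamma> v \<otimes> \<gamma> s"
      using label_dominating[OF v(3) i] by blast
    have hn: "lev h i = n"
      using h[of i] False n by simp
    have hc: "h \<in> carrier G"
      using v by simp
    have gs: "g \<otimes> sgen b s \<in> pushes b i n g" and hs: "h \<otimes> sgen b s \<in> pushes b i n h"
      using s n hn by (auto simp: pushes_def)
    have eq: "h \<otimes> sgen b s = g \<otimes> sgen b s \<otimes> sgen b' v"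
      using s v sgen_commute[of s v b b'] by (simp add: m_assoc)
    have "lev (g \<otimes> sgen b s) \<in> C'" "lev (h \<otimes> sgen b s) \<in> C'"
      using inside[OF v(4) n] inside[OF v(5) hn] delta_nonzero s v hc n hn
      by (auto simp: lev_push C'_def)
    then have "(g \<otimes> sgen b s, h \<otimes> sgen b s) \<in> edges C'"
      using s v eq by (intro edgesI[of _ v C' b']) auto
    then show ?thesis
      using pushes_connected[OF v(2,4) a gs] pushes_connected[OF hc v(5) hs c]
      by (meson rtrancl.rtrancl_into_rtrancl rtrancl_trans)
  qed
qed

lemma pushes_edge:
  assumes e: "(g, h) \<in> edges C" and a: "a \<in> pushes b i n g" and c: "c \<in> pushes b i n h"
  shows "(a, c) \<in> (edges C')\<^sup>*"
proof -
  consider "lev g i = n" | "lev h i = n" | "lev g i \<noteq> n" "lev h i \<noteq> n" by blast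
  then show ?thesis
  proof cases
    case 2
    have "(h, g) \<in> edges C"
      using e sym_edges[of C] by (metis symD)
    from pushes_edge_extreme[OF this 2 c a] show ?thesis
      using sym_rtrancl[OF sym_edges[of C']] by (metis symD)
  next
    case 3
    then have "(g, h) \<in> edges C'"
      using e by (auto simp: edges_def C'_def)
    then show ?thesis
      using a c 3 by (auto simp: pushes_def)
  qed (use pushes_edge_extreme assms in blast)
qed

text \<open>Induction along the path, with the invariant that \<open>g\<close> reaches every push of
  the current vertex. Off level \<open>n\<close> the only push of a vertex is the vertex itself, so
  both end points stay fixed.\<close>

lemma push_path:
  assumes path: "(g, h) \<in> (edges C)\<^sup>*"
    and g: "g \<in> carrier G" "lev g \<in> C'" and h: "lev h i \<noteq> n"
  shows "(g, h) \<in> (edges C')\<^sup>*"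
proof -
  have "(g, c) \<in> (edges C')\<^sup>*" if "c \<in> pushes b i n h" for c
    using path that
  proof (induction arbitrary: c rule: rtrancl_induct)
    case base
    then show ?case
      using g by (auto simp: C'_def pushes_def)
  next
    case (step y z)
    have "pushes b i n y \<noteq> {}"
      using label_nonempty[OF i] by (auto simp: pushes_def)
    then obtain a where "a \<in> pushes b i n y" by blast
    then show ?case
      using step.IH pushes_edge[OF step.hyps(2) _ step.prems] rtrancl_trans by metis
  qed
  then show ?thesis
    using h by (simp add: pushes_def)
qed

end

section \<open>Shrinking a path into the unit cube\<close>

definition box :: "('i \<Rightarrow> int) \<Rightarrow> ('i \<Rightarrow> int) \<Rightarrow> ('i \<Rightarrow> int) set" where
  "box l u = {z. \<forall>j\<in>I. l j \<le> z j \<and> z j \<le> u j}"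

text \<open>Outer layers are removed one coordinate at a time, and the total side length drops. A
  push needs a side of length at least 2, which is why the process ends at sides from 0 to 1. The
  end points have level 0 and never lie on a removed layer.\<close>

lemma box_shrink:
  assumes "(\<one>, h) \<in> (edges (box l u))\<^sup>*" and h: "\<And>j. lev h j = 0"
    and "\<And>j. j \<in> I \<Longrightarrow> l j \<le> 0" and "\<And>j. j \<in> I \<Longrightarrow> 1 \<le> u j"
  shows "(\<one>, h) \<in> (edges (box (\<lambda>_. 0) (\<lambda>_. 1)))\<^sup>*"
  using assms(1,3,4)
proof (induction "\<Sum>j\<in>I. nat (u j - l j)" arbitrary: l u rule: less_induct)
  case less
  have u0: "0 \<le> u j" if "j \<in> I" for j
    using less.prems(3)[OF that] by simp
  have smaller: "(\<Sum>j\<in>I. nat (u' j - l' j)) < (\<Sum>j\<in>I. nat (u j - l j))"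
    if "i \<in> I" "u' i - l' i < u i - l i" "l i < u i" "\<And>j. j \<noteq> i \<Longrightarrow> u' j = u j \<and> l' j = l j" for u' l' i
    by (rule sum_strict_mono_ex1[OF finite_I]) (use that in \<open>auto intro!: bexI[of _ i]\<close>, metis less_imp_le nat_mono order_refl)
  consider i where "i \<in> I" "1 < u i" | i where "i \<in> I" "l i < 0" | "\<forall>i\<in>I. l i = 0 \<and> u i = 1"
    using less.prems by (metis linorder_less_linear linorder_not_less)
  then show ?case
  proof cases
    case (1 i)
    have eq: "{z \<in> box l u. z i \<noteq> u i} = box l (u(i := u i - 1))"
      using 1 by (force simp: box_def)
    have li: "l i \<le> 0" "l i < u i"
      using less.prems(2)[of i] 1 by auto
    have "(\<one>, h) \<in> (edges {z \<in> box l u. z i \<noteq> u i})\<^sup>*"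
      by (rule push_path[where b = False])
        (use 1 li u0 less.prems in \<open>force simp: box_def h lev_one\<close>)+
    then show ?thesis
      unfolding eq by (rule less.hyps[rotated]) (use 1 li less.prems in \<open>auto intro!: smaller[of i]\<close>)
  next
    case (2 i)
    have eq: "{z \<in> box l u. z i \<noteq> l i} = box (l(i := l i + 1)) u"
      using 2 by (force simp: box_def)
    have ui: "1 \<le> u i" "l i < u i"
      using less.prems(3)[of i] 2 by auto
    have "(\<one>, h) \<in> (edges {z \<in> box l u. z i \<noteq> l i})\<^sup>*"
      by (rule push_path[where b = True])
        (use 2 ui u0 less.prems in \<open>force simp: box_def h lev_one\<close>)+
    then show ?thesis
      unfolding eq by (rule less.hyps[rotated]) (use 2 ui less.prems in \<open>auto intro!: smaller[of i]\<close>)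
  next
    case 3
    then have "box l u = box (\<lambda>_. 0) (\<lambda>_. 1)"
      by (simp add: box_def)
    with less.prems show ?thesis by simp
  qed
qed

section \<open>Finite generation of the level-zero subgroup\<close>

lemma generators_induct [consumes 1, case_names one step]:
  assumes "g \<in> carrier G" "P \<one>"
    and step: "\<And>g b v. \<lbrakk>g \<in> carrier G; P g; v \<in> V\<rbrakk> \<Longrightarrow> P (g \<otimes> sgen b v)"
  shows "P g"
proof -
  \<comment> \<open>Quantifying over the left factor \<open>k\<close> lets the claim compose, since
    \<open>generate\<close> builds arbitrarily bracketed products.\<close>
  have "\<forall>k\<in>carrier G. P k \<longrightarrow> P (k \<otimes> h)" if "h \<in> generate G (\<gamma> ` V)" for h
    using that
  proof (induction rule: generate.induct)
    case one
    then show ?case by simp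
  next
    case (incl h)
    then show ?case
      using step[of _ _ True] by (auto simp: sgen_def)
  next
    case (inv h)
    then show ?case
      using step[of _ _ False] by (auto simp: sgen_def)
  next
    case (eng h1 h2)
    have "h1 \<in> carrier G" "h2 \<in> carrier G"
      using eng.hyps generate_in_carrier[of "\<gamma> ` V"] by (auto simp: image_subset_iff)
    then show ?case
      using eng.IH by (auto simp flip: m_assoc)
  qed
  then have "P (\<one> \<otimes> g)"
    using assms(1,2) generates by blast
  then show ?thesis
    using assms(1) by simp
qed

lemma connected_in_box:
  assumes "g \<in> carrier G"
  shows "\<exists>n\<ge>1. (\<one>, g) \<in> (edges (box (\<lambda>_. - n) (\<lambda>_. n)))\<^sup>*"
  using assms
proof (induction rule: generators_induct)
  case one
  then show ?case by auto
next
  case (step g b v)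
  then obtain n where n: "n \<ge> 1" "(\<one>, g) \<in> (edges (box (\<lambda>_. - n) (\<lambda>_. n)))\<^sup>*" by blast
  \<comment> \<open>The sum bounds every coordinate of the level of \<open>g\<close>, and the extra
    1 leaves room for the new edge.\<close>
  define m where "m = n + (\<Sum>j\<in>I. \<bar>lev g j\<bar>) + 1"
  have bd: "\<bar>lev g j\<bar> \<le> m - 1" if "j \<in> I" for j
    using member_le_sum[of j I "\<lambda>j. \<bar>lev g j\<bar>"] that finite_I n by (simp add: m_def)
  have nm: "n \<le> m"
    using sum_nonneg[of I "\<lambda>j. \<bar>lev g j\<bar>"] by (simp add: m_def)
  have "box (\<lambda>_. - n) (\<lambda>_. n) \<subseteq> box (\<lambda>_. - m) (\<lambda>_. m)"
    using nm by (force simp: box_def)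
  then have "(\<one>, g) \<in> (edges (box (\<lambda>_. - m) (\<lambda>_. m)))\<^sup>*"
    using n(2) rtrancl_mono[OF edges_mono] by blast
  moreover have "(g, g \<otimes> sgen b v) \<in> edges (box (\<lambda>_. - m) (\<lambda>_. m))"
    by (rule edgesI[where b = b and v = v]) (use step bd in \<open>force simp: box_def lev_mult lev_sgen abs_le_iff\<close>)+
  ultimately show ?case
    using n nm by (meson order.trans rtrancl.rtrancl_into_rtrancl)
qed

text \<open>Schreier generators: with a representative \<open>r z\<close> for each level
  \<open>z\<close> in the cube, every edge of a path in the cube contributes one of finitely many
  products \<open>r z \<otimes> sgen b v \<otimes> inv r z'\<close>.\<close>

theorem level_zero_generated:
  "\<exists>X. finite X \<and> X \<subseteq> {g \<in> carrier G. \<forall>j. lev g j = 0} \<and>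
    {g \<in> carrier G. \<forall>j. lev g j = 0} \<subseteq> generate G X"
proof -
  let ?H = "{g \<in> carrier G. \<forall>j. lev g j = 0}"
  define Z where "Z = {z. (\<forall>j\<in>I. z j \<in> {0, 1 :: int}) \<and> (\<forall>j. j \<notin> I \<longrightarrow> z j = 0)}"
  define r where "r z = (SOME g. g \<in> carrier G \<and> lev g = z)" for z
  define q where "q g = g \<otimes> inv r (lev g)" for g
  have r: "r (lev g) \<in> carrier G \<and> lev (r (lev g)) = lev g" if "g \<in> carrier G" for g
    unfolding r_def by (rule someI[where x = g]) (use that in simp)
  \<comment> \<open>The choice \<open>r\<close> need not send the level of \<one> to \<one>, so
    \<open>r (lev \<one>)\<close> is added. The intersection keeps only products that lie in
    \<open>?H\<close>.\<close>
  define X where "X = insert (r (lev \<one>)) ((\<lambda>(z, z', b, v). r z \<otimes> sgen b v \<otimes> inv r z') ` (Z \<times> Z \<times> UNIV \<times> V)) \<inter> ?H"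
  have "finite Z"
    unfolding Z_def using finite_set_of_finite_funs[OF finite_I, of "{0, 1}" 0]
    by (rule finite_subset[rotated]) auto
  then have "finite X"
    by (simp add: X_def finite_V)
  moreover have X: "X \<subseteq> ?H"
    by (simp add: X_def)
  moreover have "?H \<subseteq> generate G X"
  proof
    fix h assume h: "h \<in> ?H"
    interpret L: subgroup "generate G X" G
      by (rule generate_is_subgroup) (use X in blast)
    have "lev (r (lev \<one>)) j = 0" for j
      using r[OF one_closed] lev_one by metis
    then have r1: "r (lev \<one>) \<in> X"
      using r[OF one_closed] unfolding X_def by blast
    obtain n where n: "n \<ge> 1" "(\<one>, h) \<in> (edges (box (\<lambda>_. - n) (\<lambda>_. n)))\<^sup>*"
      using connected_in_box h by blast
    have "(\<one>, h) \<in> (edges (box (\<lambda>_. 0) (\<lambda>_. 1)))\<^sup>*"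
      by (rule box_shrink[OF n(2)]) (use n h in auto)
    then have "q h \<in> generate G X"
    proof (induction rule: rtrancl_induct)
      case base
      have "q \<one> = inv r (lev \<one>)"
        using r[of \<one>] by (simp add: q_def)
      then show ?case
        using r1 generate.inv by metis
    next
      case (step y z)
      then obtain b v where v: "z = y \<otimes> sgen b v" "y \<in> carrier G" "v \<in> V" "z \<in> carrier G"
        and l: "lev y \<in> box (\<lambda>_. 0) (\<lambda>_. 1)" "lev z \<in> box (\<lambda>_. 0) (\<lambda>_. 1)"
        by (auto simp: edges_def)
      have Z: "lev g \<in> Z" if "lev g \<in> box (\<lambda>_. 0) (\<lambda>_. 1)" "g \<in> carrier G" for g
        using that lev_outside by (fastforce simp: Z_def box_def)
      let ?x = "r (lev y) \<otimes> sgen b v \<otimes> inv r (lev z)"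
      have "?x \<in> ?H"
        using r[of y] r[of z] v by (simp add: lev_mult lev_inv)
      then have "?x \<in> X"
        using Z[of y] Z[of z] v l unfolding X_def by force
      then have x: "q y \<otimes> ?x \<in> generate G X"
        by (rule L.m_closed[OF step.IH generate.incl])
      have "inv g \<otimes> (g \<otimes> h) = h" if "g \<in> carrier G" "h \<in> carrier G" for g h
        using that by (simp flip: m_assoc)
      \<comment> \<open>The product telescopes: the factor \<open>inv r (lev y)\<close> at the end
        of \<open>q y\<close> cancels the start of \<open>?x\<close>.\<close>
      then have "q y \<otimes> ?x = q z"
        using r[of y] r[of z] v by (simp add: q_def m_assoc)
      with x show ?case by simp
    qed
    moreover have "lev h = lev \<one>"
      using h by (auto simp: lev_one)
    \<comment> \<open>As \<open>h\<close> and \<one> have the same level, \<open>q h\<close> differs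
      from \<open>h\<close> only by the generator \<open>r (lev \<one>)\<close>.\<close>
    ultimately have "h \<otimes> inv r (lev \<one>) \<otimes> r (lev \<one>) \<in> generate G X"
      using r1 generate.incl unfolding q_def by (metis L.m_closed)
    then show "h \<in> generate G X"
      using h r[of \<one>] by (simp add: m_assoc)
  qed
  ultimately show ?thesis
    by (intro exI[of _ X] conjI)
qed

end

section \<open>Words in right-angled Artin groups\<close>

abbreviation raag_word :: "'v pair_pre_digraph \<Rightarrow> 'v gword \<Rightarrow> 'v gword set" where
  "raag_word G w \<equiv> pres_rel (pverts G) (raag_relations G) `` {w}"

lemma group_raag: "group (raag G)"
  by (simp add: raag_def group_presented_group)

lemma raag_word_closed: "w \<in> gwords (pverts G) \<Longrightarrow> raag_word G w \<in> carrier (raag G)"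
  by (simp add: raag_def presented_group_carrierI)

lemma raag_carrierE:
  assumes "A \<in> carrier (raag G)"
  obtains w where "w \<in> gwords (pverts G)" "A = raag_word G w"
  using assms unfolding raag_def by (rule presented_group_carrierE)

lemma raag_word_append:
  "\<lbrakk>u \<in> gwords (pverts G); v \<in> gwords (pverts G)\<rbrakk>
    \<Longrightarrow> raag_word G (u @ v) = raag_word G u \<otimes>\<^bsub>raag G\<^esub> raag_word G v"
  by (simp add: raag_def presented_group_mult)

lemma raag_word_Nil: "raag_word G [] = \<one>\<^bsub>raag G\<^esub>"
  by (simp add: raag_def presented_group_def)

lemma raag_word_eqI:
  assumes "pres_step (pverts G) (raag_relations G) u v" "u \<in> gwords (pverts G)" "v \<in> gwords (pverts G)"
  shows "raag_word G u = raag_word G v"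
  by (rule equiv_class_eq[OF equiv_pres_rel]) (use assms in \<open>auto simp: pres_rel_def\<close>)

lemma raag_gen_word: "raag_gen G v = raag_word G [(v, True)]"
  by (simp add: raag_gen_def pres_gen_def)

lemma raag_gen_closed: "v \<in> pverts G \<Longrightarrow> raag_gen G v \<in> carrier (raag G)"
  by (simp add: raag_gen_word raag_word_closed)

lemma raag_word_inverse_letter:
  assumes "v \<in> pverts G"
  shows "raag_word G [(v, False)] = inv\<^bsub>raag G\<^esub> raag_gen G v"
proof -
  interpret group "raag G" by (rule group_raag)
  have "raag_word G [(v, False), (v, True)] = raag_word G []"
    by (rule raag_word_eqI)
      (use pres_step.cancel[of "[]" "pverts G" "[]" v "raag_relations G" False] assms in auto)
  then have "raag_word G [(v, False)] \<otimes>\<^bsub>raag G\<^esub> raag_gen G v = \<one>\<^bsub>raag G\<^esub>"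
    using assms raag_word_append[of "[(v, False)]" G "[(v, True)]"]
    by (simp add: raag_gen_word raag_word_Nil)
  then show ?thesis
    using assms by (intro inv_equality[symmetric]) (auto simp: raag_gen_closed raag_word_closed)
qed

lemma raag_generated: "carrier (raag G) \<subseteq> generate (raag G) (raag_gen G ` pverts G)"
proof
  fix A assume "A \<in> carrier (raag G)"
  then obtain w where "w \<in> gwords (pverts G)" "A = raag_word G w"
    by (rule raag_carrierE)
  moreover have "raag_word G w \<in> generate (raag G) (raag_gen G ` pverts G)"
    if "w \<in> gwords (pverts G)" for w
    using that
  proof (induction w)
    case Nil
    then show ?case
      by (simp add: raag_word_Nil generate.one)
  next
    case (Cons p w)
    then obtain x b where p: "p = (x, b)" "x \<in> pverts G" "w \<in> gwords (pverts G)"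
      by (cases p) auto
    have "raag_word G [p] \<in> generate (raag G) (raag_gen G ` pverts G)"
      using p by (cases b)
        (auto simp: raag_word_inverse_letter simp flip: raag_gen_word intro: generate.incl generate.inv)
    with Cons p show ?case
      using raag_word_append[of "[p]" G w] by (auto intro: generate.eng)
  qed
  ultimately show "A \<in> generate (raag G) (raag_gen G ` pverts G)"
    by simp
qed

lemma raag_gen_commute:
  assumes "s \<rightarrow>\<^bsub>with_proj G\<^esub> t" "s \<in> pverts G" "t \<in> pverts G"
  shows "raag_gen G s \<otimes>\<^bsub>raag G\<^esub> raag_gen G t = raag_gen G t \<otimes>\<^bsub>raag G\<^esub> raag_gen G s"
proof -
  have "([(s, True), (t, True)], [(t, True), (s, True)]) \<in> raag_relations G"
    using assms(1) unfolding raag_relations_def by blast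
  then have "pres_step (pverts G) (raag_relations G) [(s, True), (t, True)] [(t, True), (s, True)]"
    using pres_step.relation[of "[]" "pverts G" "[]"] assms by fastforce
  then have "raag_word G [(s, True), (t, True)] = raag_word G [(t, True), (s, True)]"
    by (rule raag_word_eqI) (use assms in auto)
  then show ?thesis
    using assms raag_word_append[of "[(s, True)]" G "[(t, True)]"]
      raag_word_append[of "[(t, True)]" G "[(s, True)]"]
    by (simp add: raag_gen_word)
qed

section \<open>Finite generation forces bounded denominators\<close>

fun affine_letter :: "'v set \<Rightarrow> ('v \<Rightarrow> rat) \<Rightarrow> 'v \<times> bool \<Rightarrow> rat \<Rightarrow> rat" where
  "affine_letter S \<tau> (x, True) y = (if x \<in> S then 2 else 1) * y + \<tau> x"
| "affine_letter S \<tau> (x, False) y = (y - \<tau> x) / (if x \<in> S then 2 else 1)"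

text \<open>With \<open>foldr\<close> the last letter acts first, so concatenation becomes
  composition.\<close>

definition affine_word :: "'v set \<Rightarrow> ('v \<Rightarrow> rat) \<Rightarrow> 'v gword \<Rightarrow> rat \<Rightarrow> rat" where
  "affine_word S \<tau> = foldr (affine_letter S \<tau>)"

lemma affine_word_simps [simp]:
  "affine_word S \<tau> [] y = y"
  "affine_word S \<tau> (p # w) y = affine_letter S \<tau> p (affine_word S \<tau> w y)"
  "affine_word S \<tau> (u @ v) y = affine_word S \<tau> u (affine_word S \<tau> v y)"
  by (simp_all add: affine_word_def)

lemma affine_word_replicate:
  assumes "x \<in> S" "\<tau> x = 0"
  shows "affine_word S \<tau> (replicate n (x, True)) y = 2 ^ n * y"
    and "affine_word S \<tau> (replicate n (x, False)) y = y / 2 ^ n"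
  using assms by (induction n) auto

text \<open>
  The maps \<open>y \<mapsto> m y + \<tau>\<close> and \<open>y \<mapsto> m' y + \<tau>'\<close> commute iff \<open>(m - 1) \<tau>' = (m' - 1) \<tau>\<close>, which explains the
  hypothesis on adjacent vertices.
\<close>

lemma affine_word_pres_rel:
  assumes \<tau>: "\<And>s t. s \<rightarrow>\<^bsub>with_proj G\<^esub> t \<Longrightarrow> of_bool (s \<in> S) * \<tau> t = of_bool (t \<in> S) * \<tau> s"
    and "(u, v) \<in> pres_rel (pverts G) (raag_relations G)"
  shows "affine_word S \<tau> u = affine_word S \<tau> v"
proof -
  have single: "affine_word S \<tau> u = affine_word S \<tau> v"
    if "pres_step (pverts G) (raag_relations G) u v" for u v
    using that
  proof cases
    case (cancel u' v' x b)
    then show ?thesis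
      by (cases b) (auto simp: fun_eq_iff)
  next
    case (relation u' v' l r)
    then obtain s t where "s \<rightarrow>\<^bsub>with_proj G\<^esub> t" "l = [(s, True), (t, True)]" "r = [(t, True), (s, True)]"
      by (auto simp: raag_relations_def)
    with relation \<tau>[of s t] show ?thesis
      by (auto simp: fun_eq_iff algebra_simps of_bool_def split: if_splits)
  qed
  have "equivclp (pres_step (pverts G) (raag_relations G)) u v"
    using assms(2) by (simp add: pres_rel_def)
  then show ?thesis
  proof (induction rule: equivclp_induct)
    case (step y z)
    then show ?case
      using single by metis
  qed simp
qed

text \<open>Slopes multiply along a word, each letter of label \<open>i\<close> contributing 2 or
  1/2. In particular words of weight 0 act by translations.\<close>

lemma affine_word_linear:
  assumes "\<And>x. x \<in> fst ` set w \<Longrightarrow> x \<in> S \<longleftrightarrow> lab x = i"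
  shows "affine_word S \<tau> w y = 2 powi label_weight lab i w * y + affine_word S \<tau> w 0"
  using assms
proof (induction w)
  case (Cons p w)
  obtain x b where p: "p = (x, b)" by fastforce
  have IH: "affine_word S \<tau> w y = 2 powi label_weight lab i w * y + affine_word S \<tau> w 0"
    by (rule Cons.IH) (use Cons.prems in auto)
  have x: "x \<in> S \<longleftrightarrow> lab x = i"
    using Cons.prems p by auto
  show ?case
    using x by (cases b) (simp_all add: p IH power_int_add power_int_diff field_simps)
qed simp

lemma affine_word_dyadic:
  assumes "range \<tau> \<subseteq> \<int>"
  shows "\<exists>n::nat. 2 ^ n * affine_word S \<tau> w 0 \<in> \<int>"
proof (induction w)
  case (Cons p w)
  then obtain n where n: "2 ^ n * affine_word S \<tau> w 0 \<in> \<int>" by blast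
  obtain x b where p: "p = (x, b)" by fastforce
  have \<tau>: "\<tau> x \<in> \<int>"
    using assms by auto
  \<comment> \<open>One more factor 2 suffices, since a single letter halves at most once.\<close>
  have "2 ^ Suc n * affine_word S \<tau> (p # w) 0 \<in> \<int>"
  proof (cases b)
    case True
    have "2 ^ Suc n * affine_word S \<tau> (p # w) 0 =
      2 * ((if x \<in> S then 2 else 1) * (2 ^ n * affine_word S \<tau> w 0) + 2 ^ n * \<tau> x)"
      by (simp add: p True algebra_simps)
    also have "\<dots> \<in> \<int>"
      using n \<tau> by simp
    finally show ?thesis .
  next
    case False
    have "2 ^ Suc n * affine_word S \<tau> (p # w) 0 =
      (if x \<in> S then 1 else 2) * (2 ^ n * affine_word S \<tau> w 0 - 2 ^ n * \<tau> x)"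
      by (simp add: p False field_simps)
    also have "\<dots> \<in> \<int>"
      using n \<tau> by simp
    finally show ?thesis .
  qed
  then show ?case by blast
qed (auto intro: exI[of _ 0])

text \<open>Translations compose by addition, so a power of 2 clearing the denominators of finitely
  many generators clears those of all their products and inverses.\<close>

lemma bounded_denominators:
  assumes S: "\<And>x. x \<in> pverts G \<Longrightarrow> x \<in> S \<longleftrightarrow> lab x = i" and \<tau>: "range \<tau> \<subseteq> \<int>"
    and commute: "\<And>s t. s \<rightarrow>\<^bsub>with_proj G\<^esub> t \<Longrightarrow> of_bool (s \<in> S) * \<tau> t = of_bool (t \<in> S) * \<tau> s"
    and H: "H \<subseteq> {raag_word G w | w. w \<in> gwords (pverts G) \<and> label_weight lab i w = 0}"
    and fg: "finite X" "X \<subseteq> H" "H \<subseteq> generate (raag G) X"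
  shows "\<exists>N::nat. \<forall>w\<in>gwords (pverts G). raag_word G w \<in> H \<longrightarrow> 2 ^ N * affine_word S \<tau> w 0 \<in> \<int>"
proof -
  interpret group "raag G" by (rule group_raag)
  \<comment> \<open>The action of a group element is read off from any representing word; by
    \<open>affine_word_pres_rel\<close> the choice is immaterial.\<close>
  define \<psi> where "\<psi> A = affine_word S \<tau> (SOME w. w \<in> A)" for A :: "'a gword set"
  have \<psi>: "\<psi> (raag_word G w) = affine_word S \<tau> w" if "w \<in> gwords (pverts G)" for w
  proof -
    have "w \<in> raag_word G w"
      using that by (simp add: pres_rel_def)
    then have "(SOME u. u \<in> raag_word G w) \<in> raag_word G w"
      by (rule someI)
    then show ?thesis
      using affine_word_pres_rel[OF commute, where u = w] by (simp add: \<psi>_def)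
  qed
  have \<psi>_mult: "\<psi> (A \<otimes>\<^bsub>raag G\<^esub> B) y = \<psi> A (\<psi> B y)"
    if AB: "A \<in> carrier (raag G)" "B \<in> carrier (raag G)" for A B y
  proof -
    obtain a b where "a \<in> gwords (pverts G)" "A = raag_word G a" "b \<in> gwords (pverts G)" "B = raag_word G b"
      using AB by (metis raag_carrierE)
    then show ?thesis
      using \<psi>[of "a @ b"] by (simp add: \<psi> raag_word_append)
  qed
  have \<psi>_one: "\<psi> \<one>\<^bsub>raag G\<^esub> y = y" for y
    using \<psi>[of "[]"] by (simp add: raag_word_Nil)
  have trans: "\<psi> A y = y + \<psi> A 0" if A: "A \<in> H" for A y
  proof -
    obtain w where w: "A = raag_word G w" "w \<in> gwords (pverts G)" "label_weight lab i w = 0"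
      using H A by blast
    have "fst ` set w \<subseteq> pverts G"
      using w by (auto simp: gwords_def)
    then have "affine_word S \<tau> w y = 2 powi label_weight lab i w * y + affine_word S \<tau> w 0"
      using S by (intro affine_word_linear) auto
    then show ?thesis
      using w by (simp add: \<psi>)
  qed
  have "\<forall>A\<in>X. \<exists>n::nat. 2 ^ n * \<psi> A 0 \<in> \<int>"
  proof
    fix A assume "A \<in> X"
    then obtain w where "A = raag_word G w" "w \<in> gwords (pverts G)"
      using H fg(2) by blast
    then show "\<exists>n::nat. 2 ^ n * \<psi> A 0 \<in> \<int>"
      using affine_word_dyadic[OF \<tau>] by (simp add: \<psi>)
  qed
  from bchoice[OF this] obtain f where f: "\<forall>A\<in>X. 2 ^ f A * \<psi> A 0 \<in> \<int>" ..
  define N where "N = (\<Sum>A\<in>X. f A)"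
  have N: "2 ^ N * \<psi> A 0 \<in> \<int>" if "A \<in> X" for A
  proof -
    have "f A \<le> N"
      using that fg(1) unfolding N_def by (intro member_le_sum) auto
    then have "2 ^ N * \<psi> A 0 = 2 ^ (N - f A) * (2 ^ f A * \<psi> A 0)"
      by (simp flip: power_add mult.assoc)
    also have "\<dots> \<in> \<int>"
      by (rule Ints_mult[OF Ints_power[OF Ints_numeral]]) (use f that in blast)
    finally show ?thesis .
  qed
  \<comment> \<open>A subgroup containing \<open>X\<close> contains all that \<open>X\<close>
    generates, hence \<open>H\<close>.\<close>
  define K where "K = {A \<in> carrier (raag G). \<exists>q. 2 ^ N * q \<in> \<int> \<and> (\<forall>y. \<psi> A y = y + q)}"
  have "subgroup K (raag G)"
  proof (rule subgroupI)
    show "K \<subseteq> carrier (raag G)"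
      by (auto simp: K_def)
    have "\<one>\<^bsub>raag G\<^esub> \<in> K"
      unfolding K_def by (intro CollectI conjI exI[of _ 0]) (simp_all add: \<psi>_one)
    then show "K \<noteq> {}" by blast
    fix A assume "A \<in> K"
    then obtain q where A: "A \<in> carrier (raag G)" "2 ^ N * q \<in> \<int>" "\<And>y. \<psi> A y = y + q"
      by (auto simp: K_def)
    have "\<psi> (inv\<^bsub>raag G\<^esub> A) y = y + - q" for y
      using \<psi>_mult[of A "inv\<^bsub>raag G\<^esub> A" y] A \<psi>_one by simp
    moreover have "2 ^ N * - q \<in> \<int>"
      using A by simp
    ultimately show "inv\<^bsub>raag G\<^esub> A \<in> K"
      using A unfolding K_def by (intro CollectI conjI exI[of _ "- q"]) simp_all
    fix B assume "B \<in> K"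
    then obtain r where B: "B \<in> carrier (raag G)" "2 ^ N * r \<in> \<int>" "\<And>y. \<psi> B y = y + r"
      by (auto simp: K_def)
    have "\<psi> (A \<otimes>\<^bsub>raag G\<^esub> B) y = y + (q + r)" for y
      using A B by (simp add: \<psi>_mult)
    moreover have "2 ^ N * (q + r) \<in> \<int>"
      using A B by (simp add: distrib_left)
    ultimately show "A \<otimes>\<^bsub>raag G\<^esub> B \<in> K"
      using A B unfolding K_def by (intro CollectI conjI exI[of _ "q + r"]) simp_all
  qed
  moreover have "X \<subseteq> K"
  proof
    fix A assume A: "A \<in> X"
    then have "A \<in> H" "A \<in> carrier (raag G)"
      using H fg(2) raag_word_closed[of _ G] by blast+
    moreover have "\<forall>y. \<psi> A y = y + \<psi> A 0"
      using trans \<open>A \<in> H\<close> by blast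
    ultimately show "A \<in> K"
      using N[OF A] unfolding K_def by blast
  qed
  ultimately have "H \<subseteq> K"
    using fg(3) generate_subgroup_incl by blast
  then have "2 ^ N * affine_word S \<tau> w 0 \<in> \<int>" if w: "w \<in> gwords (pverts G)" "raag_word G w \<in> H" for w
  proof -
    obtain q where "2 ^ N * q \<in> \<int>" "\<And>y. \<psi> (raag_word G w) y = y + q"
      using \<open>H \<subseteq> K\<close> w(2) unfolding K_def by blast
    then show ?thesis
      using \<psi>[OF w(1)] by (metis add_0)
  qed
  then show ?thesis by blast
qed

section \<open>Generalized Bestvina-Brady subgroups\<close>

lemma (in group) finitely_generated_subgroup_iff:
  assumes "subgroup H G"
  shows "finitely_generated (G\<lparr>carrier := H\<rparr>) \<longleftrightarrow>
    (\<exists>X. finite X \<and> X \<subseteq> H \<and> H \<subseteq> generate G X)"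
proof -
  have "generate (G\<lparr>carrier := H\<rparr>) X = H \<longleftrightarrow> H \<subseteq> generate G X" if "X \<subseteq> H" for X
    using generate_consistent[OF that assms] generate_subgroup_incl[OF that assms] by auto
  then show ?thesis
    by (auto simp: finitely_generated_def)
qed

lemma std_basis_eq_iff: "i \<in> {1..d} \<Longrightarrow> std_basis d j = std_basis d i \<longleftrightarrow> j = i"
  by (auto simp: std_basis_def dest!: fun_cong[of _ _ i] split: if_splits)

text \<open>Connectedness is defined by symmetrising the arcs and by reachability relative to the
  vertex set. Adjacency is already symmetric, so an ordinary reflexive transitive closure remains;
  nonemptiness belongs to the definition.\<close>

lemma connected_induce_subgraph_iff:
  assumes "pair_graph G" "S \<subseteq> pverts G"
  shows "Digraph_Component.connected (with_proj G \<restriction> S) \<longleftrightarrow>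
    S \<noteq> {} \<and> (\<forall>u\<in>S. \<forall>v\<in>S. (u, v) \<in> {(x, y). x \<rightarrow>\<^bsub>with_proj G\<^esub> y \<and> x \<in> S \<and> y \<in> S}\<^sup>*)"
proof -
  interpret pair_graph G by fact
  let ?R = "{(x, y). x \<rightarrow>\<^bsub>with_proj G\<^esub> y \<and> x \<in> S \<and> y \<in> S}"
  have sym: "(y, x) \<in> parcs G" if "(x, y) \<in> parcs G" for x y
    using that pair_sym_arcs by (auto simp: symmetric_def dest: symD)
  have R: "parcs (mk_symmetric (with_proj G \<restriction> S)) = ?R"
    by (auto simp: parcs_mk_symmetric induce_subgraph_def intro: sym)
  have "(u, v) \<in> rtrancl_on S ?R \<longleftrightarrow> (u, v) \<in> ?R\<^sup>*" if "u \<in> S" "v \<in> S" for u v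
  proof
    assume "(u, v) \<in> ?R\<^sup>*"
    then show "(u, v) \<in> rtrancl_on S ?R"
      by (rule rtrancl_consistent_rtrancl_on) (use that in simp_all)
  qed (rule rtrancl_on_rtranclI)
  then show ?thesis
    unfolding Digraph_Component.connected_def strongly_connected_def reachable_def with_proj_simps R
    by simp
qed

section \<open>The level map of a labelled right-angled Artin group\<close>

locale labelled_raag =
  fixes G :: "'v pair_pre_digraph" and d :: nat and lab :: "'v \<Rightarrow> nat"
    and \<Phi> :: "'v gword set \<Rightarrow> (nat \<Rightarrow> int)"
  assumes graph: "pair_graph G" and labelling: "labelling_epi G d lab \<Phi>"
begin

sublocale group "raag G"
  by (rule group_raag)

lemma finite_verts: "finite (pverts G)"
proof -
  interpret pair_graph G by (rule graph)
  show ?thesis by (rule pair_finite_verts)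
qed

lemma adj_sym: "s \<rightarrow>\<^bsub>with_proj G\<^esub> t \<Longrightarrow> t \<rightarrow>\<^bsub>with_proj G\<^esub> s"
proof -
  interpret pair_graph G by (rule graph)
  show "s \<rightarrow>\<^bsub>with_proj G\<^esub> t \<Longrightarrow> t \<rightarrow>\<^bsub>with_proj G\<^esub> s"
    using pair_sym_arcs by (auto simp: symmetric_def dest: symD)
qed

lemma label_range: "v \<in> pverts G \<Longrightarrow> lab v \<in> {1..d}"
  using labelling by (auto simp: labelling_epi_def)

lemma basis_verts_eq: "i \<in> {1..d} \<Longrightarrow> basis_verts G d \<Phi> i = {v \<in> pverts G. lab v = i}"
  using labelling std_basis_eq_iff[of i d]
  by (auto simp: basis_verts_def labelling_epi_def)

lemma Phi_hom: "group_hom (raag G) (Zpow d) \<Phi>"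
  using labelling group_raag
  by (intro group_hom.intro group_hom_axioms.intro) (auto simp: labelling_epi_def epi_def Zpow_def)

text \<open>Values of \<Phi> are \<open>undefined\<close> outside \<open>{1..d}\<close>; the default
  0 makes every coordinate additive.\<close>

definition level :: "'v gword set \<Rightarrow> nat \<Rightarrow> int" where
  "level A j = (if j \<in> {1..d} then \<Phi> A j else 0)"

lemma level_mult:
  "\<lbrakk>A \<in> carrier (raag G); B \<in> carrier (raag G)\<rbrakk> \<Longrightarrow> level (A \<otimes>\<^bsub>raag G\<^esub> B) j = level A j + level B j"
  using group_hom.hom_mult[OF Phi_hom, of A B] by (simp add: level_def Zpow_def)

lemma level_gen: "v \<in> pverts G \<Longrightarrow> level (raag_gen G v) j = of_bool (lab v = j)"
  using labelling label_range[of v] by (auto simp: level_def labelling_epi_def std_basis_def)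

lemma level_one: "level \<one>\<^bsub>raag G\<^esub> j = 0"
  using level_mult[of "\<one>\<^bsub>raag G\<^esub>" "\<one>\<^bsub>raag G\<^esub>" j] by simp

lemma level_word: "w \<in> gwords (pverts G) \<Longrightarrow> level (raag_word G w) j = label_weight lab j w"
proof (induction w)
  case Nil
  then show ?case
    by (simp add: raag_word_Nil level_one)
next
  case (Cons p w)
  then obtain x b where p: "p = (x, b)" "x \<in> pverts G" "w \<in> gwords (pverts G)"
    by (cases p) auto
  have x: "raag_gen G x \<in> carrier (raag G)"
    using p by (simp add: raag_gen_closed)
  have "level (inv\<^bsub>raag G\<^esub> raag_gen G x) j = - level (raag_gen G x) j"
    using level_mult[OF x inv_closed[OF x], of j] x by (simp add: level_one)
  then have "level (raag_word G [p]) j = (if lab x = j then if b then 1 else - 1 else 0)"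
    using p by (cases b) (simp_all add: raag_word_inverse_letter level_gen flip: raag_gen_word)
  with Cons p show ?case
    using raag_word_append[of "[p]" G w] by (simp add: level_mult raag_word_closed)
qed

lemma gen_bestvina_brady_eq: "gen_bestvina_brady G d \<Phi> = {A \<in> carrier (raag G). \<forall>j. level A j = 0}"
proof -
  have "\<Phi> A = \<one>\<^bsub>Zpow d\<^esub> \<longleftrightarrow> (\<forall>j. level A j = 0)" if "A \<in> carrier (raag G)" for A
  proof -
    have "\<Phi> A \<in> extensional {1..d}"
      using group_hom.hom_closed[OF Phi_hom that] by (auto simp: Zpow_def PiE_def)
    then show ?thesis
      by (auto simp: level_def Zpow_def fun_eq_iff extensional_def)
  qed
  then show ?thesis
    by (auto simp: gen_bestvina_brady_def kernel_def)
qed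

lemma finitely_generated_iff:
  "finitely_generated (raag G\<lparr>carrier := gen_bestvina_brady G d \<Phi>\<rparr>) \<longleftrightarrow>
    (\<exists>X. finite X \<and> X \<subseteq> gen_bestvina_brady G d \<Phi> \<and> gen_bestvina_brady G d \<Phi> \<subseteq> generate (raag G) X)"
  unfolding gen_bestvina_brady_def
  by (rule finitely_generated_subgroup_iff[OF group_hom.subgroup_kernel[OF Phi_hom]])

lemma word_in_gen_bestvina_brady:
  "w \<in> gwords (pverts G) \<Longrightarrow> raag_word G w \<in> gen_bestvina_brady G d \<Phi> \<longleftrightarrow> (\<forall>j. label_weight lab j w = 0)"
  by (simp add: gen_bestvina_brady_eq raag_word_closed level_word)

text \<open>Otherwise every word has weight 0 in label \<open>i\<close>, and the \<open>i\<close>-th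
  basis vector is missed, against surjectivity.\<close>

lemma label_used:
  assumes "i \<in> {1..d}"
  shows "\<exists>v\<in>pverts G. lab v = i"
proof (rule ccontr)
  assume no: "\<not> ?thesis"
  have "std_basis d i \<in> \<Phi> ` carrier (raag G)"
    using labelling by (auto simp: labelling_epi_def epi_def Zpow_def std_basis_def)
  then obtain A where A: "A \<in> carrier (raag G)" "std_basis d i = \<Phi> A" by blast
  then obtain w where w: "w \<in> gwords (pverts G)" "A = raag_word G w"
    using raag_carrierE by blast
  have "label_weight lab i w = 0"
    using w(1) no by (induction w) auto
  then have "\<Phi> A i = 0"
    using level_word[OF w(1), of i] assms w(2) by (simp add: level_def)
  then show False
    using fun_cong[OF A(2), of i] assms by (simp add: std_basis_def)
qed

section \<open>Sufficiency of connectedness and domination\<close>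

lemma finitely_generatedI:
  assumes "\<And>i. i \<in> {1..d} \<Longrightarrow> Digraph_Component.connected (basis_subgraph G d \<Phi> i)"
    and "\<And>i. i \<in> {1..d} \<Longrightarrow> dominating (basis_subgraph G d \<Phi> i) (with_proj G)"
  shows "finitely_generated (raag G\<lparr>carrier := gen_bestvina_brady G d \<Phi>\<rparr>)"
proof -
  interpret levelled_group "raag G" "pverts G" "raag_gen G" "{1..d}" lab level
  proof
    fix s t assume st: "s \<in> pverts G" "t \<in> pverts G" "lab s = lab t"
    define S where "S = basis_verts G d \<Phi> (lab s)"
    have S: "S = {v \<in> pverts G. lab v = lab s}"
      using label_range[OF st(1)] by (simp add: S_def basis_verts_eq)
    have "Digraph_Component.connected (with_proj G \<restriction> S)"
      using assms(1)[OF label_range[OF st(1)]] by (simp add: basis_subgraph_def S_def)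
    then have "(s, t) \<in> {(x, y). x \<rightarrow>\<^bsub>with_proj G\<^esub> y \<and> x \<in> S \<and> y \<in> S}\<^sup>*"
      using connected_induce_subgraph_iff[OF graph, of S] st S by auto
    moreover have "{(x, y). x \<rightarrow>\<^bsub>with_proj G\<^esub> y \<and> x \<in> S \<and> y \<in> S} \<subseteq>
      {(x, y). x \<in> pverts G \<and> y \<in> pverts G \<and> lab x = lab s \<and> lab y = lab s \<and>
        raag_gen G x \<otimes>\<^bsub>raag G\<^esub> raag_gen G y = raag_gen G y \<otimes>\<^bsub>raag G\<^esub> raag_gen G x}"
      using raag_gen_commute[of _ _ G] by (auto simp: S)
    ultimately show "(s, t) \<in> {(x, y). x \<in> pverts G \<and> y \<in> pverts G \<and> lab x = lab s \<and> lab y = lab s \<and>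
        raag_gen G x \<otimes>\<^bsub>raag G\<^esub> raag_gen G y = raag_gen G y \<otimes>\<^bsub>raag G\<^esub> raag_gen G x}\<^sup>*"
      using rtrancl_mono by blast
  next
    fix v i assume vi: "v \<in> pverts G" "i \<in> {1..d}" "lab v \<noteq> i"
    then obtain s where "s \<in> pverts G" "lab s = i" "v \<rightarrow>\<^bsub>with_proj G\<^esub> s"
      using assms(2)[OF vi(2)]
      by (auto simp: dominating_def basis_subgraph_def induce_subgraph_def basis_verts_eq)
    then show "\<exists>s\<in>pverts G. lab s = i \<and>
        raag_gen G s \<otimes>\<^bsub>raag G\<^esub> raag_gen G v = raag_gen G v \<otimes>\<^bsub>raag G\<^esub> raag_gen G s"
      using raag_gen_commute[of v s G] vi by auto
  qed (use finite_verts raag_gen_closed raag_generated level_mult level_gen label_used in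
      \<open>auto simp: level_def\<close>)
  show ?thesis
    using level_zero_generated unfolding finitely_generated_iff unfolding gen_bestvina_brady_eq .
qed

section \<open>Necessity of domination and connectedness\<close>

lemma affine_obstruction:
  assumes fg: "finitely_generated (raag G\<lparr>carrier := gen_bestvina_brady G d \<Phi>\<rparr>)"
    and S: "S = {x \<in> pverts G. lab x = i}" and \<tau>: "range \<tau> \<subseteq> \<int>"
    and commute: "\<And>s t. s \<rightarrow>\<^bsub>with_proj G\<^esub> t \<Longrightarrow> of_bool (s \<in> S) * \<tau> t = of_bool (t \<in> S) * \<tau> s"
    and w: "\<And>n. w n \<in> gwords (pverts G)" "\<And>n j. label_weight lab j (w n) = 0"
    and "\<And>n. \<exists>k\<in>\<int>. affine_word S \<tau> (w n) 0 = 1 / 2 ^ n + k"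
  shows False
proof -
  have H: "gen_bestvina_brady G d \<Phi> \<subseteq>
      {raag_word G w | w. w \<in> gwords (pverts G) \<and> label_weight lab i w = 0}"
    by (auto simp: gen_bestvina_brady_eq level_word elim!: raag_carrierE)
  obtain X where "finite X" "X \<subseteq> gen_bestvina_brady G d \<Phi>" "gen_bestvina_brady G d \<Phi> \<subseteq> generate (raag G) X"
    using fg finitely_generated_iff by blast
  moreover have "x \<in> S \<longleftrightarrow> lab x = i" if "x \<in> pverts G" for x
    using that S by simp
  ultimately have "\<exists>N::nat. \<forall>u\<in>gwords (pverts G). raag_word G u \<in> gen_bestvina_brady G d \<Phi> \<longrightarrow>
      2 ^ N * affine_word S \<tau> u 0 \<in> \<int>"
    by (intro bounded_denominators[OF _ \<tau> commute H])
  then obtain N :: nat where N: "\<And>u. u \<in> gwords (pverts G) \<Longrightarrow> raag_word G u \<in> gen_bestvina_brady G d \<Phi> \<Longrightarrow>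
      2 ^ N * affine_word S \<tau> u 0 \<in> \<int>"
    by blast
  \<comment> \<open>Index \<open>Suc N\<close> is one beyond the bound: multiplying by
    \<open>2 ^ N\<close> leaves 1/2 up to an integer.\<close>
  obtain k where k: "k \<in> \<int>" "affine_word S \<tau> (w (Suc N)) 0 = 1 / 2 ^ Suc N + k"
    using assms(7) by blast
  have "2 ^ N * (1 / 2 ^ Suc N + k) \<in> \<int>"
    using N[OF w(1), of "Suc N"] w(2) word_in_gen_bestvina_brady[OF w(1), of "Suc N"] k(2) by simp
  moreover have "2 ^ N * (1 / 2 ^ Suc N + k) = 1 / 2 + 2 ^ N * k"
    by (simp add: field_simps)
  ultimately have "1 / 2 + 2 ^ N * k - 2 ^ N * k \<in> \<int>"
    using k(1) by (metis Ints_diff Ints_mult Ints_numeral Ints_power)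
  then obtain z where "1 / 2 = (of_int z :: rat)"
    by (auto elim: Ints_cases)
  then have "(1 :: rat) = of_int (2 * z)"
    by simp
  then have "1 = 2 * z"
    by (metis of_int_1 of_int_eq_iff)
  then show False
    by presburger
qed

lemma finitely_generated_imp_dominating:
  assumes fg: "finitely_generated (raag G\<lparr>carrier := gen_bestvina_brady G d \<Phi>\<rparr>)" and i: "i \<in> {1..d}"
  shows "dominating (basis_subgraph G d \<Phi> i) (with_proj G)"
proof (rule ccontr)
  assume "\<not> ?thesis"
  then obtain v where v: "v \<in> pverts G" "lab v \<noteq> i"
    and no: "\<And>s. s \<in> pverts G \<Longrightarrow> lab s = i \<Longrightarrow> \<not> v \<rightarrow>\<^bsub>with_proj G\<^esub> s"
    using i by (auto simp: dominating_def basis_subgraph_def induce_subgraph_def basis_verts_eq)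
  obtain s where s: "s \<in> pverts G" "lab s = i"
    using label_used[OF i] by blast
  define S where "S = {x \<in> pverts G. lab x = i}"
  \<comment> \<open>Commutation could fail only on an edge between \<open>v\<close> and a vertex of
    \<open>S\<close>, and there is none.\<close>
  define \<tau> :: "'v \<Rightarrow> rat" where "\<tau> x = of_bool (x = v)" for x
  \<comment> \<open>A commutator of \<open>v\<close> with a power of \<open>s\<close>, so all
    weights vanish. It moves 0 through -1, \<open>- (2 ^ n)\<close> and \<open>1 - 2 ^ n\<close> to
    \<open>1 / 2 ^ n - 1\<close>.\<close>
  define w where "w n = replicate n (s, False) @ [(v, True)] @ replicate n (s, True) @ [(v, False)]" for n
  have commute: "of_bool (x \<in> S) * \<tau> y = of_bool (y \<in> S) * \<tau> x" if "x \<rightarrow>\<^bsub>with_proj G\<^esub> y" for x y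
    using that no adj_sym[OF that] by (auto simp: S_def \<tau>_def)
  have sS: "s \<in> S" "v \<notin> S" "\<tau> s = 0" "\<tau> v = 1"
    using s v by (auto simp: S_def \<tau>_def)
  show False
  proof (rule affine_obstruction[OF fg S_def _ commute, of w])
    show "range \<tau> \<subseteq> \<int>"
      by (auto simp: \<tau>_def)
    show "w n \<in> gwords (pverts G)" for n
      using s v by (auto simp: w_def gwords_def)
    show "label_weight lab j (w n) = 0" for n j
      by (simp add: w_def label_weight_replicate)
    show "\<exists>k\<in>\<int>. affine_word S \<tau> (w n) 0 = 1 / 2 ^ n + k" for n
      using sS by (intro bexI[of _ "- 1"]) (auto simp: w_def affine_word_replicate field_simps)
  qed
qed

lemma finitely_generated_imp_connected:
  assumes fg: "finitely_generated (raag G\<lparr>carrier := gen_bestvina_brady G d \<Phi>\<rparr>)" and i: "i \<in> {1..d}"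
  shows "Digraph_Component.connected (basis_subgraph G d \<Phi> i)"
proof (rule ccontr)
  assume not_connected: "\<not> ?thesis"
  define S where "S = {x \<in> pverts G. lab x = i}"
  let ?R = "{(x, y). x \<rightarrow>\<^bsub>with_proj G\<^esub> y \<and> x \<in> S \<and> y \<in> S}"
  have "S \<noteq> {}"
    using label_used[OF i] by (auto simp: S_def)
  then obtain a b where ab: "a \<in> S" "b \<in> S" "(a, b) \<notin> ?R\<^sup>*"
    using not_connected connected_induce_subgraph_iff[OF graph, of S] i
    by (auto simp: basis_subgraph_def basis_verts_eq S_def)
  \<comment> \<open>This indicates the part of \<open>S\<close> outside the component of
    \<open>a\<close>. It is constant along edges within \<open>S\<close> and zero off
    \<open>S\<close>, which yields commutation.\<close>
  define \<tau> :: "'v \<Rightarrow> rat" where "\<tau> x = of_bool (x \<in> S \<and> (a, x) \<notin> ?R\<^sup>*)" for x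
  \<comment> \<open>A conjugate of \<open>b\<close> times the inverse of \<open>a\<close>, in the
    kernel because both have label \<open>i\<close>. As \<open>a\<close> fixes 0, only
    \<open>b\<close> moves it, to 1, which the leading letters halve \<open>n\<close> times.\<close>
  define w where "w n = replicate n (a, False) @ [(b, True), (a, False)] @ replicate n (a, True)" for n
  have closed: "(a, y) \<in> ?R\<^sup>*" if "x \<rightarrow>\<^bsub>with_proj G\<^esub> y" "x \<in> S" "y \<in> S" "(a, x) \<in> ?R\<^sup>*" for x y
    using that by (intro rtrancl_into_rtrancl[of a x ?R y]) auto
  have commute: "of_bool (x \<in> S) * \<tau> y = of_bool (y \<in> S) * \<tau> x" if "x \<rightarrow>\<^bsub>with_proj G\<^esub> y" for x y
  proof -
    have "(a, x) \<in> ?R\<^sup>* \<longleftrightarrow> (a, y) \<in> ?R\<^sup>*" if "x \<in> S" "y \<in> S"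
      using closed[of x y] closed[of y x] \<open>x \<rightarrow>\<^bsub>with_proj G\<^esub> y\<close> adj_sym that by blast
    then show ?thesis
      by (auto simp: \<tau>_def)
  qed
  have \<tau>ab: "\<tau> a = 0" "\<tau> b = 1"
    using ab by (auto simp: \<tau>_def)
  show False
  proof (rule affine_obstruction[OF fg S_def _ commute, of w])
    show "range \<tau> \<subseteq> \<int>"
      by (auto simp: \<tau>_def)
    show "w n \<in> gwords (pverts G)" for n
      using ab by (auto simp: w_def gwords_def S_def)
    show "label_weight lab j (w n) = 0" for n j
      using ab by (auto simp: w_def label_weight_replicate S_def)
    show "\<exists>k\<in>\<int>. affine_word S \<tau> (w n) 0 = 1 / 2 ^ n + k" for n
      using ab \<tau>ab by (intro bexI[of _ 0]) (auto simp: w_def affine_word_replicate)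
  qed
qed

end

theorem theorem1p8:
  fixes G :: "'v pair_pre_digraph" and d :: nat and lab :: "'v \<Rightarrow> nat"
    and \<Phi> :: "'v gword set \<Rightarrow> (nat \<Rightarrow> int)"
  assumes "pair_graph G"
    and "0 < d" and "d \<le> card (pverts G)"
    and "labelling_epi G d lab \<Phi>"
  shows "finitely_generated (raag G\<lparr>carrier := gen_bestvina_brady G d \<Phi>\<rparr>) \<longleftrightarrow>
    (\<forall>i\<in>{1..d}. Digraph_Component.connected (basis_subgraph G d \<Phi> i) \<and>
                dominating (basis_subgraph G d \<Phi> i) (with_proj G))"
proof -
  interpret labelled_raag G d lab \<Phi>
    using assms(1,4) by (rule labelled_raag.intro)
  show ?thesis
    using finitely_generatedI finitely_generated_imp_dominating finitely_generated_imp_connected by blast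
qed

end
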